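(* The class of finitely presented semigroups is not $\equiv$-complete for the ceers; that is, there is a ceer $R$ such that $R\not\equiv {=_S}$ for every finitely presented semigroup $S$.
   Context: A ceer is a computably enumerable equivalence relation on $\omega$. For equivalence relations $R,S$ on $\omega$, $R\le S$ means that there is a computable function $f$ with $x \mathrel{R} y \Leftrightarrow f(x)\mathrel{S} f(y)$ for all $x,y$; $R\equiv S$ means $R\le S$ and $S\le R$. A finitely presented semigroup is one of the form $S=\langle X;R\rangle$, where $X$ is a finite nonempty set of generators, $R$ is a finite binary relation on the free semigroup $F(X)$ of nonempty words over $X$, and $\langle X;R\rangle$ denotes the quotient of $F(X)$ by the congruence $N_R$ generated by $R$. Its word problem $=_S$ is the c.e. congruence $N_R$ on $F(X)$, viewed as a ceer via a computable bijection of $F(X)$ with $\omega$. A class of algebras is $\equiv$-complete for the ceers if every ceer is $\equiv$ to the word problem of some member of the class. *)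

theory Defs
  imports Main "HOL-Library.Nat_Bijection"
begin

text \<open>
  Partial recursive functions, as the functions denoted by terms built from the initial functions by
  composition, primitive recursion and minimization. A term has no fixed arity: it denotes one
  partial function for each length of the argument list.
\<close>

datatype recf =
    Zero
  | Succ
  | Proj nat
  | Comp recf "recf list"
  | PrimRec recf recf
  | Mu recf

fun rec_eval :: "recf \<Rightarrow> nat list \<Rightarrow> nat option" where
  "rec_eval Zero xs = Some 0"
| "rec_eval Succ xs = (case xs of [x] \<Rightarrow> Some (Suc x) | _ \<Rightarrow> None)"
| "rec_eval (Proj i) xs = (if i < length xs then Some (xs ! i) else None)"
| "rec_eval (Comp f gs) xs =
     (let vs = map (\<lambda>g. rec_eval g xs) gs
      in if None \<in> set vs then None else rec_eval f (map the vs))"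
| "rec_eval (PrimRec f g) xs =
     (case xs of
        [] \<Rightarrow> None
      | n # ys \<Rightarrow>
          rec_nat (rec_eval f ys) (\<lambda>m r. Option.bind r (\<lambda>v. rec_eval g (m # v # ys))) n)"
| "rec_eval (Mu f) xs =
     (if \<exists>n. rec_eval f (n # xs) = Some 0 \<and> (\<forall>m<n. rec_eval f (m # xs) \<noteq> None)
      then Some (LEAST n. rec_eval f (n # xs) = Some 0) else None)"

definition computable :: "(nat \<Rightarrow> nat) \<Rightarrow> bool" where
  "computable f \<longleftrightarrow> (\<exists>p. \<forall>x. rec_eval p [x] = Some (f x))"

definition ce_rel :: "nat rel \<Rightarrow> bool" where
  "ce_rel R \<longleftrightarrow> (\<exists>p. R = {(x, y). rec_eval p [x, y] \<noteq> None})"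

definition ceer :: "nat rel \<Rightarrow> bool" where
  "ceer R \<longleftrightarrow> equiv UNIV R \<and> ce_rel R"

definition reducible :: "nat rel \<Rightarrow> nat rel \<Rightarrow> bool"  (infix "\<preceq>\<^sub>c" 50) where
  "R \<preceq>\<^sub>c S \<longleftrightarrow> (\<exists>f. computable f \<and> (\<forall>x y. (x, y) \<in> R \<longleftrightarrow> (f x, f y) \<in> S))"

definition bireducible :: "nat rel \<Rightarrow> nat rel \<Rightarrow> bool"  (infix "\<equiv>\<^sub>c" 50) where
  "R \<equiv>\<^sub>c S \<longleftrightarrow> R \<preceq>\<^sub>c S \<and> S \<preceq>\<^sub>c R"

definition free_semigroup :: "'a set \<Rightarrow> 'a list set" where
  "free_semigroup X = {w. w \<noteq> [] \<and> set w \<subseteq> X}"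

definition finite_presentation :: "'a set \<Rightarrow> 'a list rel \<Rightarrow> bool" where
  "finite_presentation X E \<longleftrightarrow>
     finite X \<and> X \<noteq> {} \<and> finite E \<and> E \<subseteq> free_semigroup X \<times> free_semigroup X"

inductive_set generated_congruence :: "'a set \<Rightarrow> 'a list rel \<Rightarrow> 'a list rel"
  for X :: "'a set" and E :: "'a list rel" where
  base: "(u, v) \<in> E \<Longrightarrow> (u, v) \<in> generated_congruence X E"
| refl: "u \<in> free_semigroup X \<Longrightarrow> (u, u) \<in> generated_congruence X E"
| sym: "(u, v) \<in> generated_congruence X E \<Longrightarrow> (v, u) \<in> generated_congruence X E"
| trans: "\<lbrakk>(u, v) \<in> generated_congruence X E; (v, w) \<in> generated_congruence X E\<rbrakk>
    \<Longrightarrow> (u, w) \<in> generated_congruence X E"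
| left: "\<lbrakk>(u, v) \<in> generated_congruence X E; w \<in> free_semigroup X\<rbrakk>
    \<Longrightarrow> (w @ u, w @ v) \<in> generated_congruence X E"
| right: "\<lbrakk>(u, v) \<in> generated_congruence X E; w \<in> free_semigroup X\<rbrakk>
    \<Longrightarrow> (u @ w, v @ w) \<in> generated_congruence X E"

text \<open>
  Words over a set of natural numbers are coded by \<^const>\<open>list_encode\<close>; this is what computability
  of a bijection between \<^typ>\<open>nat\<close> and the free semigroup refers to. For finite \<open>X\<close> the codes of
  words over \<open>X\<close> form a decidable set, so the inverse bijection is then computable on that set.
\<close>

definition computable_word_bijection :: "nat set \<Rightarrow> (nat \<Rightarrow> nat list) \<Rightarrow> bool" where
  "computable_word_bijection X e \<longleftrightarrow>
     bij_betw e UNIV (free_semigroup X) \<and> computable (\<lambda>n. list_encode (e n))"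

definition word_problem :: "'a set \<Rightarrow> 'a list rel \<Rightarrow> (nat \<Rightarrow> 'a list) \<Rightarrow> nat rel" where
  "word_problem X E e = {(i, j). (e i, e j) \<in> generated_congruence X E}"

end

theory Submission
  imports Defs
begin

text \<open>
  Let \<open>f\<close> be an injective computable function with undecidable range, and let \<open>A\<close> be its deficiency
  set, \<open>s \<in> A \<longleftrightarrow> (\<exists>t>s. f t < f s)\<close>. It is hypersimple: the complement is infinite, and
  if a computable \<open>h\<close> were such that \<open>{..h n}\<close> always contains \<open>n\<close> elements of the complement, then one of
  them, \<open>s\<close>, would satisfy \<open>f s \<ge> n - 1\<close>, hence all values of \<open>f\<close> below \<open>n - 1\<close> would be
  attained up to stage \<open>h n\<close>, and the range of \<open>f\<close> would be decidable. On the other hand, in an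
  infinite finitely generated semigroup the words of length at most \<open>n\<close> represent at least \<open>n\<close>
  elements, so a reduction of its word problem to the ceer collapsing \<open>A\<close> to one class would
  provide such an \<open>h\<close>.
\<close>

section \<open>Closure properties of total recursive functions\<close>

text \<open>The arguments form one list, so that closure rules can be stated for arbitrary
  expressions in \<open>xs\<close>; only lists of length \<open>k\<close> count.\<close>

definition recfn :: "nat \<Rightarrow> (nat list \<Rightarrow> nat) \<Rightarrow> bool" where
  "recfn k F \<longleftrightarrow> (\<exists>p. \<forall>xs. length xs = k \<longrightarrow> rec_eval p xs = Some (F xs))"

named_theorems recfn_intros

lemma computable_iff_recfn: "computable f \<longleftrightarrow> recfn 1 (\<lambda>xs. f (xs ! 0))"
proof
  assume "computable f"
  then obtain p where p: "\<And>x. rec_eval p [x] = Some (f x)" unfolding computable_def by blast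
  then have "rec_eval p xs = Some (f (xs ! 0))" if "length xs = 1" for xs
    using that by (cases xs) auto
  then show "recfn 1 (\<lambda>xs. f (xs ! 0))" unfolding recfn_def by blast
next
  assume "recfn 1 (\<lambda>xs. f (xs ! 0))"
  then obtain p where p: "\<And>xs. length xs = 1 \<Longrightarrow> rec_eval p xs = Some (f (xs ! 0))"
    unfolding recfn_def by blast
  have "rec_eval p [x] = Some (f x)" for x using p[of "[x]"] by simp
  then show "computable f" unfolding computable_def by blast
qed

lemma recfn_cong: "(\<And>xs. length xs = k \<Longrightarrow> F xs = G xs) \<Longrightarrow> recfn k F = recfn k G"
  unfolding recfn_def by auto

text \<open>Inside a recursion or a search the parameters appear as a \<open>drop\<close> of the
  argument list; this rule projects onto them.\<close>

lemma recfn_drop [recfn_intros]: "i + j < k \<Longrightarrow> recfn k (\<lambda>xs. drop j xs ! i)"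
  unfolding recfn_def by (rule exI[of _ "Proj (i + j)"]) (auto simp: add.commute)

lemma recfn_nth [recfn_intros]: "i < k \<Longrightarrow> recfn k (\<lambda>xs. xs ! i)"
  using recfn_drop[of i 0 k] by simp

lemma recfn_comp:
  assumes F: "recfn (length as) F" and as: "\<And>a. a \<in> set as \<Longrightarrow> recfn k a"
  shows "recfn k (\<lambda>xs. F (map (\<lambda>a. a xs) as))"
proof -
  obtain p where p: "\<And>xs. length xs = length as \<Longrightarrow> rec_eval p xs = Some (F xs)"
    using F unfolding recfn_def by blast
  have "\<forall>a\<in>set as. \<exists>q. \<forall>xs. length xs = k \<longrightarrow> rec_eval q xs = Some (a xs)"
    using as unfolding recfn_def by blast
  then obtain q where q: "\<And>a xs. a \<in> set as \<Longrightarrow> length xs = k \<Longrightarrow> rec_eval (q a) xs = Some (a xs)"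
    by metis
  have "rec_eval (Comp p (map q as)) xs = Some (F (map (\<lambda>a. a xs) as))" if "length xs = k" for xs
  proof -
    have "map (\<lambda>g. rec_eval g xs) (map q as) = map Some (map (\<lambda>a. a xs) as)"
      using q that by simp
    then show ?thesis using p by (simp add: Let_def del: map_map) (simp add: comp_def)
  qed
  then show ?thesis unfolding recfn_def by blast
qed

lemma recfn_comp1:
  assumes "recfn 1 (\<lambda>ys. F (ys ! 0))" "recfn k a"
  shows "recfn k (\<lambda>xs. F (a xs))"
  using recfn_comp[of "[a]" "\<lambda>ys. F (ys ! 0)" k] assms by simp

lemma recfn_Suc [recfn_intros]:
  assumes "recfn k a"
  shows "recfn k (\<lambda>xs. Suc (a xs))"
proof (rule recfn_comp1[OF _ assms])
  have "rec_eval Succ xs = Some (Suc (xs ! 0))" if "length xs = 1" for xs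
    using that by (cases xs) auto
  then show "recfn 1 (\<lambda>ys. Suc (ys ! 0))" unfolding recfn_def by blast
qed

lemma recfn_const [recfn_intros]: "recfn k (\<lambda>xs. c)"
proof (induction c)
  case 0
  show ?case unfolding recfn_def by (rule exI[of _ Zero]) simp
next
  case (Suc c)
  then show ?case by (rule recfn_Suc)
qed

lemma recfn_primrec:
  assumes n: "recfn k n" and a: "recfn k a"
    and g: "recfn (Suc (Suc k)) (\<lambda>ys. g (ys ! 0) (ys ! 1) (drop 2 ys))"
  shows "recfn k (\<lambda>xs. rec_nat (a xs) (\<lambda>m r. g m r xs) (n xs))"
proof -
  obtain p where p: "\<And>xs. length xs = k \<Longrightarrow> rec_eval p xs = Some (a xs)"
    using a unfolding recfn_def by blast
  obtain q where q: "\<And>xs. length xs = Suc (Suc k) \<Longrightarrow>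
      rec_eval q xs = Some (g (xs ! 0) (xs ! 1) (drop 2 xs))"
    using g unfolding recfn_def by blast
  have ev: "rec_eval (PrimRec p q) (m # xs) = Some (rec_nat (a xs) (\<lambda>m r. g m r xs) m)"
    if "length xs = k" for m xs
    using p q that by (induction m) auto
  have "recfn (Suc k) (\<lambda>ys. rec_nat (a (tl ys)) (\<lambda>m r. g m r (tl ys)) (ys ! 0))"
    unfolding recfn_def
  proof (intro exI allI impI)
    fix ys :: "nat list" assume "length ys = Suc k"
    then show "rec_eval (PrimRec p q) ys
        = Some (rec_nat (a (tl ys)) (\<lambda>m r. g m r (tl ys)) (ys ! 0))"
      using ev by (cases ys) auto
  qed
  \<comment> \<open>\<open>PrimRec\<close> recurses on its first argument; feeding it
    \<open>n\<close> followed by the \<open>k\<close> projections allows a computed number of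
    iterations.\<close>
  then have "recfn k (\<lambda>xs. (\<lambda>ys. rec_nat (a (tl ys)) (\<lambda>m r. g m r (tl ys)) (ys ! 0))
      (map (\<lambda>b. b xs) (n # map (\<lambda>i xs. xs ! i) [0..<k])))"
    using n by (intro recfn_comp) (auto intro: recfn_nth)
  moreover have "map (\<lambda>i. xs ! i) [0..<k] = xs" if "length xs = k" for xs :: "nat list"
    using that map_nth by blast
  ultimately show ?thesis
    by (subst (asm) recfn_cong) (auto simp: comp_def)
qed

lemma recfn_Least:
  assumes F: "recfn (Suc k) (\<lambda>ys. F (ys ! 0) (drop 1 ys))"
    and ex: "\<And>xs. length xs = k \<Longrightarrow> \<exists>n. F n xs = 0"
  shows "recfn k (\<lambda>xs. LEAST n. F n xs = 0)"
proof -
  obtain p where p: "\<And>xs. length xs = Suc k \<Longrightarrow> rec_eval p xs = Some (F (xs ! 0) (drop 1 xs))"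
    using F unfolding recfn_def by blast
  have "rec_eval (Mu p) xs = Some (LEAST n. F n xs = 0)" if "length xs = k" for xs
    using p ex that by simp
  then show ?thesis unfolding recfn_def by blast
qed

lemma recfn_add [recfn_intros]:
  assumes "recfn k a" "recfn k b"
  shows "recfn k (\<lambda>xs. a xs + b xs)"
proof -
  have "recfn k (\<lambda>xs. rec_nat (a xs) (\<lambda>m r. Suc r) (b xs))"
    by (intro recfn_primrec assms recfn_intros) simp
  moreover have "rec_nat x (\<lambda>m r. Suc r) y = x + y" for x y :: nat
    by (induction y) auto
  ultimately show ?thesis by simp
qed

lemma recfn_pred:
  assumes "recfn k a"
  shows "recfn k (\<lambda>xs. a xs - 1)"
proof -
  have "recfn k (\<lambda>xs. rec_nat 0 (\<lambda>m r. m) (a xs))"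
    by (intro recfn_primrec assms recfn_intros) simp
  moreover have "rec_nat 0 (\<lambda>m r. m) y = y - 1" for y :: nat
    by (cases y) auto
  ultimately show ?thesis by simp
qed

lemma recfn_diff [recfn_intros]:
  assumes "recfn k a" "recfn k b"
  shows "recfn k (\<lambda>xs. a xs - b xs)"
proof -
  have "recfn k (\<lambda>xs. rec_nat (a xs) (\<lambda>m r. r - 1) (b xs))"
    by (intro recfn_primrec assms recfn_pred recfn_intros) simp
  moreover have "rec_nat x (\<lambda>m r. r - 1) y = x - y" for x y :: nat
    by (induction y) auto
  ultimately show ?thesis by simp
qed

text \<open>Recursion along the distance of the two compared values: zero steps return the first
  branch, and any positive number of steps yields the second, as the step function ignores counter
  and accumulator.\<close>

lemma recfn_if_eq [recfn_intros]:
  assumes "recfn k a" "recfn k b" "recfn k c" "recfn k d"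
  shows "recfn k (\<lambda>xs. if a xs = b xs then c xs else d xs)"
proof -
  have "recfn k (\<lambda>xs. rec_nat (c xs) (\<lambda>m r. d xs) ((a xs - b xs) + (b xs - a xs)))"
  proof (intro recfn_primrec recfn_add recfn_diff assms)
    have "recfn (Suc (Suc k)) (\<lambda>ys. d (map (\<lambda>b. b ys) (map (\<lambda>i ys. drop 2 ys ! i) [0..<k])))"
      using assms by (intro recfn_comp) (auto intro!: recfn_drop)
    moreover have "map (\<lambda>i. ys ! (2 + i)) [0..<k] = drop 2 ys" if "length ys = Suc (Suc k)" for ys :: "nat list"
      using that by (intro nth_equalityI) auto
    ultimately show "recfn (Suc (Suc k)) (\<lambda>ys. d (drop 2 ys))"
      by (subst (asm) recfn_cong) (auto simp: comp_def)
  qed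
  moreover have "rec_nat u (\<lambda>m r. v) ((x - y) + (y - x)) = (if x = y then u else v)" for x y u v :: nat
    by (cases "(x - y) + (y - x)") auto
  ultimately show ?thesis by simp
qed

section \<open>The pairing function and its projections\<close>

lemma recfn_triangle [recfn_intros]:
  assumes "recfn k a"
  shows "recfn k (\<lambda>xs. triangle (a xs))"
proof -
  have "recfn k (\<lambda>xs. rec_nat 0 (\<lambda>m r. r + Suc m) (a xs))"
    by (intro recfn_primrec assms recfn_intros) simp_all
  moreover have "rec_nat 0 (\<lambda>m r. r + Suc m) y = triangle y" for y :: nat
    by (induction y) auto
  ultimately show ?thesis by simp
qed

lemma recfn_prod_encode [recfn_intros]:
  "recfn k a \<Longrightarrow> recfn k b \<Longrightarrow> recfn k (\<lambda>xs. prod_encode (a xs, b xs))"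
  unfolding prod_encode_def by (simp add: recfn_intros)

text \<open>\<open>w\<close> is the number of the diagonal containing \<open>z\<close>, the least
  one with \<open>z < triangle (Suc w)\<close>; truncated subtraction turns this inequality into the
  equation that minimization requires.\<close>

lemma prod_decode_Least:
  fixes z :: nat
  defines "w \<equiv> LEAST w. Suc z - triangle (Suc w) = 0"
  shows "fst (prod_decode z) = z - triangle w" "snd (prod_decode z) = w - (z - triangle w)"
proof -
  obtain a b where ab: "prod_decode z = (a, b)" by fastforce
  then have z: "z = triangle (a + b) + a"
    using prod_decode_inverse[of z] by (simp add: prod_encode_def)
  have mono: "triangle i \<le> triangle j" if "i \<le> j" for i j
    using that by (induction j) (auto simp: le_Suc_eq)
  have "w = a + b" unfolding w_def
  proof (rule Least_equality)
    show "Suc z - triangle (Suc (a + b)) = 0" using z by simp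
  next
    fix y assume y: "Suc z - triangle (Suc y) = 0"
    show "a + b \<le> y"
    proof (rule ccontr)
      assume "\<not> a + b \<le> y"
      then have "triangle (Suc y) \<le> triangle (a + b)" by (intro mono) simp
      then show False using y z by simp
    qed
  qed
  then show "fst (prod_decode z) = z - triangle w" "snd (prod_decode z) = w - (z - triangle w)"
    using ab z by auto
qed

lemma recfn_triangle_root:
  "recfn 1 (\<lambda>xs. LEAST w. Suc (xs ! 0) - triangle (Suc w) = 0)"
proof (rule recfn_Least)
  show "recfn (Suc 1) (\<lambda>ys. Suc (drop 1 ys ! 0) - triangle (Suc (ys ! 0)))"
    by (intro recfn_intros) auto
  have "z \<le> triangle z" for z by (induction z) auto
  then show "\<exists>w. Suc (xs ! 0) - triangle (Suc w) = 0" for xs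
    by (intro exI[of _ "xs ! 0"]) (simp add: le_SucI add_increasing)
qed

definition pfst :: "nat \<Rightarrow> nat" where "pfst z = fst (prod_decode z)"
definition psnd :: "nat \<Rightarrow> nat" where "psnd z = snd (prod_decode z)"

lemma pfst_prod_encode [simp]: "pfst (prod_encode (a, b)) = a"
  and psnd_prod_encode [simp]: "psnd (prod_encode (a, b)) = b"
  by (simp_all add: pfst_def psnd_def)

lemma recfn_pfst [recfn_intros]: "recfn k a \<Longrightarrow> recfn k (\<lambda>xs. pfst (a xs))"
  unfolding pfst_def prod_decode_Least
  by (intro recfn_intros recfn_comp1[OF recfn_triangle_root])

lemma recfn_psnd [recfn_intros]: "recfn k a \<Longrightarrow> recfn k (\<lambda>xs. psnd (a xs))"
  unfolding psnd_def prod_decode_Least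
  by (intro recfn_intros recfn_comp1[OF recfn_triangle_root])

lemma recfn_funpow:
  assumes F: "recfn 1 (\<lambda>xs. F (xs ! 0))" and "recfn k n" "recfn k a"
  shows "recfn k (\<lambda>xs. (F ^^ n xs) (a xs))"
proof -
  have "recfn k (\<lambda>xs. rec_nat (a xs) (\<lambda>m r. F r) (n xs))"
    by (intro recfn_primrec assms recfn_comp1[OF F] recfn_intros) simp
  moreover have "rec_nat x (\<lambda>m r. F r) y = (F ^^ y) x" for x y
    by (induction y) auto
  ultimately show ?thesis by simp
qed

text \<open>Such sums later serve as computable upper bounds for the values of \<open>F\<close> at
  all arguments up to \<open>n xs\<close> at once.\<close>

lemma recfn_sum_le:
  assumes F: "recfn 1 (\<lambda>xs. F (xs ! 0))" and n: "recfn k n"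
  shows "recfn k (\<lambda>xs. \<Sum>i\<le>n xs. F i)"
proof -
  have "recfn k (\<lambda>xs. rec_nat (F 0) (\<lambda>m r. r + F (Suc m)) (n xs))"
    by (intro recfn_primrec n recfn_intros recfn_comp1[OF F]) simp_all
  moreover have "rec_nat (F 0) (\<lambda>m r. r + F (Suc m)) y = (\<Sum>i\<le>y. F i)" for y
    by (induction y) auto
  ultimately show ?thesis by simp
qed

lemma recfn_sum_finite:
  assumes "finite X" "\<And>x. x \<in> X \<Longrightarrow> recfn k (F x)"
  shows "recfn k (\<lambda>xs. \<Sum>x\<in>X. F x xs)"
  using assms by (induction X rule: finite_induct) (auto intro: recfn_intros)

section \<open>An abstract machine evaluating recursive functions\<close>

text \<open>\<open>pcons\<close>, \<open>phd\<close> and \<open>ptl\<close> act on codes as the list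
  operations do under \<open>list_encode\<close>, with 0 as the empty list.\<close>

definition pcons :: "nat \<Rightarrow> nat \<Rightarrow> nat" where "pcons x l = Suc (prod_encode (x, l))"
definition phd :: "nat \<Rightarrow> nat" where "phd l = pfst (l - 1)"
definition ptl :: "nat \<Rightarrow> nat" where "ptl l = psnd (l - 1)"

lemma phd_pcons [simp]: "phd (pcons x l) = x"
  and ptl_pcons [simp]: "ptl (pcons x l) = l"
  and pcons_neq_0 [simp]: "pcons x l \<noteq> 0"
  by (simp_all add: pcons_def phd_def ptl_def)

lemma list_encode_Cons: "list_encode (x # xs) = pcons x (list_encode xs)"
  by (simp add: pcons_def)

lemma recfn_pcons [recfn_intros]: "recfn k a \<Longrightarrow> recfn k b \<Longrightarrow> recfn k (\<lambda>xs. pcons (a xs) (b xs))"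
  unfolding pcons_def by (intro recfn_intros)

lemma recfn_phd [recfn_intros]: "recfn k a \<Longrightarrow> recfn k (\<lambda>xs. phd (a xs))"
  unfolding phd_def by (intro recfn_intros)

lemma recfn_ptl [recfn_intros]: "recfn k a \<Longrightarrow> recfn k (\<lambda>xs. ptl (a xs))"
  unfolding ptl_def by (intro recfn_intros)

text \<open>
  The arguments of a composition are listed in reverse, so that evaluating them one after the
  other and pushing the values onto a list restores their order.
\<close>

fun encode_recf :: "recf \<Rightarrow> nat" where
  "encode_recf Zero = prod_encode (0, 0)"
| "encode_recf Succ = prod_encode (1, 0)"
| "encode_recf (Proj i) = prod_encode (2, i)"
| "encode_recf (Comp f gs) =
     prod_encode (3, prod_encode (encode_recf f, list_encode (rev (map encode_recf gs))))"
| "encode_recf (PrimRec f g) = prod_encode (4, prod_encode (encode_recf f, encode_recf g))"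
| "encode_recf (Mu f) = prod_encode (5, encode_recf f)"

text \<open>
  \<open>eval_state p xs K\<close> starts the evaluation of \<open>p\<close> on \<open>xs\<close>, and \<open>ret_state v K\<close> returns the value \<open>v\<close>
  to the topmost frame of the stack \<open>K\<close>. Returning to the empty stack leads to \<open>dead_state\<close>, so that
  \<open>ret_state v 0\<close> occurs at most once in a run.
\<close>

definition eval_state :: "nat \<Rightarrow> nat \<Rightarrow> nat \<Rightarrow> nat" where
  "eval_state p xs K = prod_encode (0, prod_encode (p, prod_encode (xs, K)))"
definition ret_state :: "nat \<Rightarrow> nat \<Rightarrow> nat" where
  "ret_state v K = prod_encode (1, prod_encode (v, K))"
definition dead_state :: nat where
  "dead_state = prod_encode (2, 0)"

definition comp_frame :: "nat \<Rightarrow> nat \<Rightarrow> nat \<Rightarrow> nat \<Rightarrow> nat" where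
  "comp_frame f gs xs vs = prod_encode (0, prod_encode (f, prod_encode (gs, prod_encode (xs, vs))))"
definition primrec_frame :: "nat \<Rightarrow> nat \<Rightarrow> nat \<Rightarrow> nat \<Rightarrow> nat" where
  "primrec_frame g ys m n = prod_encode (1, prod_encode (g, prod_encode (ys, prod_encode (m, n))))"
definition mu_frame :: "nat \<Rightarrow> nat \<Rightarrow> nat \<Rightarrow> nat" where
  "mu_frame f xs n = prod_encode (2, prod_encode (f, prod_encode (xs, n)))"

text \<open>\<open>gs\<close> lists the arguments still to be evaluated and \<open>vs\<close> the
  values already obtained.\<close>

definition args_state :: "nat \<Rightarrow> nat \<Rightarrow> nat \<Rightarrow> nat \<Rightarrow> nat \<Rightarrow> nat" where
  "args_state f gs xs vs K =
     (if gs = 0 then eval_state f vs K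
      else eval_state (phd gs) xs (pcons (comp_frame f (ptl gs) xs vs) K))"

text \<open>The tags are those of \<open>encode_recf\<close>. Where the recursive function is
  undefined the behaviour is arbitrary: only defined values have to be reproduced.\<close>

definition step_eval :: "nat \<Rightarrow> nat \<Rightarrow> nat \<Rightarrow> nat \<Rightarrow> nat" where
  "step_eval c q xs K =
     (if c = 0 then ret_state 0 K
      else if c = 1 then ret_state (Suc (phd xs)) K
      else if c = 2 then ret_state (phd ((ptl ^^ q) xs)) K
      else if c = 3 then args_state (pfst q) (psnd q) xs 0 K
      else if c = 4 then
        eval_state (pfst q) (ptl xs) (pcons (primrec_frame (psnd q) (ptl xs) 0 (phd xs)) K)
      else eval_state q (pcons 0 xs) (pcons (mu_frame q xs 0) K))"

text \<open>Here \<open>v\<close> is the value of the recursion at \<open>m\<close>, and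
  \<open>n\<close> is the argument at which its value is wanted.\<close>

definition step_primrec :: "nat \<Rightarrow> nat \<Rightarrow> nat \<Rightarrow> nat \<Rightarrow> nat \<Rightarrow> nat \<Rightarrow> nat" where
  "step_primrec v g ys m n K =
     (if m = n then ret_state v K
      else eval_state g (pcons m (pcons v ys)) (pcons (primrec_frame g ys (Suc m) n) K))"

definition step_mu :: "nat \<Rightarrow> nat \<Rightarrow> nat \<Rightarrow> nat \<Rightarrow> nat \<Rightarrow> nat" where
  "step_mu v f xs n K =
     (if v = 0 then ret_state n K
      else eval_state f (pcons (Suc n) xs) (pcons (mu_frame f xs (Suc n)) K))"

definition step_ret :: "nat \<Rightarrow> nat \<Rightarrow> nat \<Rightarrow> nat \<Rightarrow> nat" where
  "step_ret v c q K =
     (if c = 0 then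
        args_state (pfst q) (pfst (psnd q)) (pfst (psnd (psnd q))) (pcons v (psnd (psnd (psnd q)))) K
      else if c = 1 then
        step_primrec v (pfst q) (pfst (psnd q)) (pfst (psnd (psnd q))) (psnd (psnd (psnd q))) K
      else step_mu v (pfst q) (pfst (psnd q)) (psnd (psnd q)) K)"

definition step :: "nat \<Rightarrow> nat" where
  "step s =
     (if pfst s = 0 then
        step_eval (pfst (pfst (psnd s))) (psnd (pfst (psnd s))) (pfst (psnd (psnd s))) (psnd (psnd (psnd s)))
      else if pfst s = 1 then
        (if psnd (psnd s) = 0 then dead_state
         else step_ret (pfst (psnd s)) (pfst (phd (psnd (psnd s)))) (psnd (phd (psnd (psnd s)))) (ptl (psnd (psnd s))))
      else s)"

lemma step_eval_state:
  "step (eval_state (prod_encode (c, q)) xs K) = step_eval c q xs K"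
  by (simp add: step_def eval_state_def)

lemma step_ret_state:
  "step (ret_state v 0) = dead_state"
  "step (ret_state v (pcons (comp_frame f gs xs vs) K)) = args_state f gs xs (pcons v vs) K"
  "step (ret_state v (pcons (primrec_frame g ys m n) K)) = step_primrec v g ys m n K"
  "step (ret_state v (pcons (mu_frame f xs m) K)) = step_mu v f xs m K"
  by (simp_all add: step_def ret_state_def step_ret_def comp_frame_def primrec_frame_def mu_frame_def)

lemma step_dead_state: "step dead_state = dead_state"
  by (simp add: step_def dead_state_def)

lemma recfn_step: "recfn 1 (\<lambda>xs. step (xs ! 0))"
proof -
  have ptl: "recfn 1 (\<lambda>xs. ptl (xs ! 0))" by (intro recfn_intros) simp
  show ?thesis
    unfolding step_def step_eval_def step_ret_def step_primrec_def step_mu_def args_state_def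
      eval_state_def ret_state_def dead_state_def comp_frame_def primrec_frame_def mu_frame_def
    by (intro recfn_intros recfn_funpow[OF ptl]) simp_all
qed

section \<open>Correctness of the machine\<close>

definition reaches :: "nat \<Rightarrow> nat \<Rightarrow> bool" where
  "reaches s t \<longleftrightarrow> (\<exists>n. (step ^^ n) s = t)"

lemma reaches_refl: "reaches s s"
  unfolding reaches_def by (rule exI[of _ 0]) simp

lemma reaches_trans: "reaches s t \<Longrightarrow> reaches t u \<Longrightarrow> reaches s u"
  unfolding reaches_def by (metis comp_apply funpow_add)

lemma reaches_step: "reaches (step s) t \<Longrightarrow> reaches s t"
  unfolding reaches_def by (metis comp_apply funpow_Suc_right)

lemma funpow_ptl_list_encode:
  "i < length xs \<Longrightarrow> phd ((ptl ^^ i) (list_encode xs)) = xs ! i"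
proof (induction i arbitrary: xs)
  case 0
  then show ?case by (cases xs) (auto simp: list_encode_Cons simp del: list_encode.simps(2))
next
  case (Suc i)
  then show ?case
    by (cases xs) (auto simp: list_encode_Cons funpow_swap1 simp del: list_encode.simps(2) funpow.simps
        simp add: funpow_Suc_right)
qed

text \<open>Induction from the right end, since the reversed list hands out the last argument first;
  \<open>ws\<close> holds the values already obtained, to which the others are prepended.\<close>

lemma reaches_args_state:
  assumes "\<And>g v K. g \<in> set gs \<Longrightarrow> rec_eval g xs = Some v \<Longrightarrow>
      reaches (eval_state (encode_recf g) (list_encode xs) K) (ret_state v K)"
    and "map (\<lambda>g. rec_eval g xs) gs = map Some vs"
  shows "reaches (args_state f (list_encode (rev (map encode_recf gs))) (list_encode xs) (list_encode ws) K)
      (eval_state f (list_encode (vs @ ws)) K)"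
  using assms
proof (induction gs arbitrary: vs ws rule: rev_induct)
  case Nil
  then show ?case by (simp add: args_state_def reaches_refl)
next
  case (snoc g gs)
  obtain vs' v where vs: "vs = vs' @ [v]" using snoc.prems(2) by (cases vs rule: rev_cases) auto
  have v: "rec_eval g xs = Some v" "map (\<lambda>g. rec_eval g xs) gs = map Some vs'"
    using snoc.prems(2) vs by auto
  have "reaches (eval_state (encode_recf g) (list_encode xs)
       (pcons (comp_frame f (list_encode (rev (map encode_recf gs))) (list_encode xs) (list_encode ws)) K))
     (ret_state v (pcons (comp_frame f (list_encode (rev (map encode_recf gs))) (list_encode xs) (list_encode ws)) K))"
    using snoc.prems(1) v by simp
  moreover have "reaches (args_state f (list_encode (rev (map encode_recf gs))) (list_encode xs) (list_encode (v # ws)) K)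
      (eval_state f (list_encode (vs' @ v # ws)) K)"
    using snoc.prems(1) by (intro snoc.IH v) auto
  ultimately show ?case
    unfolding vs
    by (simp add: args_state_def[where gs = "pcons _ _"] list_encode_Cons del: list_encode.simps(2))
      (erule reaches_trans, rule reaches_step, simp add: step_ret_state)
qed

text \<open>Loop invariant: with counter \<open>n\<close> in the frame, the returned value is that
  of the recursion at \<open>n\<close>. The target \<open>N\<close> is kept apart from
  \<open>n\<close>, so that the induction leaves it unchanged.\<close>

lemma reaches_primrec:
  assumes IH: "\<And>xs v K. rec_eval g xs = Some v \<Longrightarrow>
      reaches (eval_state (encode_recf g) (list_encode xs) K) (ret_state v K)"
    and "rec_nat a (\<lambda>m r. Option.bind r (\<lambda>v. rec_eval g (m # v # ys))) n = Some v"
    and "a = Some u" and "n \<le> N"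
  shows "reaches (ret_state u (pcons (primrec_frame (encode_recf g) (list_encode ys) 0 N) K))
    (ret_state v (pcons (primrec_frame (encode_recf g) (list_encode ys) n N) K))"
  using assms(2,4)
proof (induction n arbitrary: v)
  case 0
  then show ?case using assms(3) by (simp add: reaches_refl)
next
  case (Suc n)
  then obtain w where w: "rec_nat a (\<lambda>m r. Option.bind r (\<lambda>v. rec_eval g (m # v # ys))) n = Some w"
    "rec_eval g (n # w # ys) = Some v"
    by (auto simp: bind_eq_Some_conv)
  have "reaches (eval_state (encode_recf g) (list_encode (n # w # ys))
        (pcons (primrec_frame (encode_recf g) (list_encode ys) (Suc n) N) K))
      (ret_state v (pcons (primrec_frame (encode_recf g) (list_encode ys) (Suc n) N) K))"
    by (rule IH[OF w(2)])
  then have "reaches (ret_state w (pcons (primrec_frame (encode_recf g) (list_encode ys) n N) K))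
    (ret_state v (pcons (primrec_frame (encode_recf g) (list_encode ys) (Suc n) N) K))"
    using Suc.prems by (intro reaches_step[of "ret_state _ _"])
      (simp add: step_ret_state step_primrec_def list_encode_Cons del: list_encode.simps(2))
  then show ?case using Suc.IH[OF w(1)] Suc.prems by (auto intro: reaches_trans)
qed

lemma reaches_mu:
  assumes IH: "\<And>xs v K. rec_eval f xs = Some v \<Longrightarrow>
      reaches (eval_state (encode_recf f) (list_encode xs) K) (ret_state v K)"
    and "\<And>m. m < n \<Longrightarrow> \<exists>v. rec_eval f (m # xs) = Some v \<and> v \<noteq> 0"
  shows "reaches
    (eval_state (encode_recf f) (list_encode (0 # xs)) (pcons (mu_frame (encode_recf f) (list_encode xs) 0) K))
    (eval_state (encode_recf f) (list_encode (n # xs)) (pcons (mu_frame (encode_recf f) (list_encode xs) n) K))"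
  using assms(2)
proof (induction n)
  case 0
  show ?case by (rule reaches_refl)
next
  case (Suc n)
  then obtain v where v: "rec_eval f (n # xs) = Some v" "v \<noteq> 0" by blast
  have "reaches (ret_state v (pcons (mu_frame (encode_recf f) (list_encode xs) n) K))
    (eval_state (encode_recf f) (list_encode (Suc n # xs)) (pcons (mu_frame (encode_recf f) (list_encode xs) (Suc n)) K))"
    using v by (intro reaches_step[of "ret_state _ _"])
      (simp add: step_ret_state step_mu_def list_encode_Cons reaches_refl del: list_encode.simps(2))
  then show ?case using Suc IH[OF v(1)] by (meson less_SucI reaches_trans)
qed

text \<open>Structural induction with an arbitrary stack, as a subterm is evaluated on top of the
  frames of the terms containing it.\<close>

lemma reaches_ret_state:
  "rec_eval p xs = Some v \<Longrightarrow>
     reaches (eval_state (encode_recf p) (list_encode xs) K) (ret_state v K)"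
proof (induction p arbitrary: xs v K)
  case Zero
  then show ?case by (intro reaches_step[of "eval_state _ _ _"])
    (simp add: step_eval_state step_eval_def reaches_refl)
next
  case Succ
  then show ?case by (intro reaches_step[of "eval_state _ _ _"])
    (auto simp: step_eval_state step_eval_def reaches_refl list_encode_Cons simp del: list_encode.simps(2)
       split: list.splits)
next
  case (Proj i)
  then show ?case by (intro reaches_step[of "eval_state _ _ _"])
    (auto simp: step_eval_state step_eval_def reaches_refl funpow_ptl_list_encode split: if_splits)
next
  case (Comp f gs)
  define vs where "vs = map (\<lambda>g. the (rec_eval g xs)) gs"
  have *: "None \<notin> (\<lambda>g. rec_eval g xs) ` set gs" "rec_eval f vs = Some v"
    using Comp.prems by (auto simp: Let_def vs_def comp_def split: if_splits)
  have "map (\<lambda>g. rec_eval g xs) gs = map Some vs"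
    using *(1) by (simp add: vs_def image_iff) (metis option.collapse)
  then have "reaches (args_state (encode_recf f) (list_encode (rev (map encode_recf gs))) (list_encode xs) (list_encode []) K)
      (eval_state (encode_recf f) (list_encode (vs @ [])) K)"
    using Comp.IH(2) by (intro reaches_args_state)
  then show ?case using Comp.IH(1)[OF *(2)]
    by (intro reaches_step[of "eval_state _ _ _"])
      (auto simp: step_eval_state step_eval_def intro: reaches_trans)
next
  case (PrimRec f g)
  then obtain n ys where xs: "xs = n # ys" by (cases xs) auto
  let ?r = "rec_nat (rec_eval f ys) (\<lambda>m r. Option.bind r (\<lambda>v. rec_eval g (m # v # ys)))"
  have n: "?r n = Some v" using PrimRec.prems xs by simp
  \<comment> \<open>Undefinedness propagates through the recursion, so a defined result forces the
    base value to be defined.\<close>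
  have "?r m = None" if "rec_eval f ys = None" for m using that by (induction m) auto
  then obtain u where u: "rec_eval f ys = Some u" using n by fastforce
  have "reaches (ret_state v (pcons (primrec_frame (encode_recf g) (list_encode ys) n n) K)) (ret_state v K)"
    by (intro reaches_step[of "ret_state _ _"]) (simp add: step_ret_state step_primrec_def reaches_refl)
  moreover have "reaches (ret_state u (pcons (primrec_frame (encode_recf g) (list_encode ys) 0 n) K))
    (ret_state v (pcons (primrec_frame (encode_recf g) (list_encode ys) n n) K))"
    using PrimRec.IH(2) n u by (intro reaches_primrec) auto
  moreover note PrimRec.IH(1)[OF u]
  ultimately have "reaches (eval_state (encode_recf f) (list_encode ys)
      (pcons (primrec_frame (encode_recf g) (list_encode ys) 0 n) K)) (ret_state v K)"
    by (meson reaches_trans)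
  then show ?case unfolding xs
    by (intro reaches_step[of "eval_state _ _ _"])
      (simp add: step_eval_state step_eval_def list_encode_Cons del: list_encode.simps(2))
next
  case (Mu f)
  let ?P = "\<lambda>n. rec_eval f (n # xs) = Some 0"
  from Mu.prems obtain n where n: "?P n" "\<forall>m<n. rec_eval f (m # xs) \<noteq> None" and v: "v = (LEAST n. ?P n)"
    by (auto split: if_splits)
  have v0: "?P v" unfolding v by (rule LeastI) (rule n)
  \<comment> \<open>The least zero is at most the witness \<open>n\<close>, so all earlier values
    are defined, and they are nonzero by minimality.\<close>
  have "v \<le> n" unfolding v by (rule Least_le) (rule n)
  then have "\<exists>w. rec_eval f (m # xs) = Some w \<and> w \<noteq> 0" if "m < v" for m
  proof -
    have "rec_eval f (m # xs) \<noteq> None" using that \<open>v \<le> n\<close> n(2) by auto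
    moreover have "\<not> ?P m" using that unfolding v by (rule not_less_Least)
    ultimately show ?thesis by auto
  qed
  then have "reaches
    (eval_state (encode_recf f) (list_encode (0 # xs)) (pcons (mu_frame (encode_recf f) (list_encode xs) 0) K))
    (eval_state (encode_recf f) (list_encode (v # xs)) (pcons (mu_frame (encode_recf f) (list_encode xs) v) K))"
    using Mu.IH by (intro reaches_mu)
  moreover note Mu.IH[OF v0]
  moreover have "reaches (ret_state 0 (pcons (mu_frame (encode_recf f) (list_encode xs) v) K)) (ret_state v K)"
    by (intro reaches_step[of "ret_state _ _"]) (simp add: step_ret_state step_mu_def reaches_refl)
  ultimately have "reaches (eval_state (encode_recf f) (list_encode (0 # xs))
      (pcons (mu_frame (encode_recf f) (list_encode xs) 0) K)) (ret_state v K)"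
    by (meson reaches_trans)
  then show ?case
    by (intro reaches_step[of "eval_state _ _ _"])
      (simp add: step_eval_state step_eval_def list_encode_Cons del: list_encode.simps(2))
qed

section \<open>An injective computable function with undecidable range\<close>

text \<open>The program with code \<open>e\<close> is run on its own code; \<open>pcons e 0\<close>
  encodes a one-element list.\<close>

definition start_state :: "nat \<Rightarrow> nat" where "start_state e = eval_state e (pcons e 0) 0"

definition halts_at :: "nat \<Rightarrow> nat \<Rightarrow> bool" where
  "halts_at e s \<longleftrightarrow> (step ^^ s) (start_state e) = ret_state 0 0"

lemma ret_state_eq_iff [simp]: "ret_state v K = ret_state w L \<longleftrightarrow> v = w \<and> K = L"
  and ret_state_neq_dead_state [simp]: "ret_state v K \<noteq> dead_state"
  by (simp_all add: ret_state_def dead_state_def)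

text \<open>A return to the empty stack is followed by the dead state forever, so no second one can
  occur.\<close>

lemma funpow_ret_state_unique:
  assumes "(step ^^ m) s = ret_state v 0" "(step ^^ n) s = ret_state w 0"
  shows "m = n"
proof -
  have dead: "(step ^^ Suc i) (ret_state u 0) = dead_state" for i u
    by (induction i) (simp_all add: step_ret_state step_dead_state)
  have False if "i < j" "(step ^^ i) s = ret_state u 0" "(step ^^ j) s = ret_state u' 0" for i j u u'
  proof -
    obtain k where "j = Suc k + i" using \<open>i < j\<close> less_imp_Suc_add by (metis add.commute add_Suc_right)
    then have "(step ^^ j) s = (step ^^ Suc k) ((step ^^ i) s)" by (metis comp_apply funpow_add)
    then show False using that dead by (metis ret_state_neq_dead_state)
  qed
  then show ?thesis using assms by (metis linorder_neqE_nat)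
qed

text \<open>Take for \<open>e\<close> the code of a program for \<open>c\<close>. Run on
  \<open>e\<close> it returns \<open>c e\<close>, and uniqueness of the return excludes halting with
  0 when \<open>c e\<close> is nonzero. Hence no computable function vanishes exactly off this
  halting set.\<close>

lemma computable_diagonal:
  assumes "computable c"
  shows "\<exists>e. c e = 0 \<longleftrightarrow> (\<exists>s. halts_at e s)"
proof -
  obtain p where p: "\<And>x. rec_eval p [x] = Some (c x)" using assms unfolding computable_def by blast
  define e where "e = encode_recf p"
  have "reaches (start_state e) (ret_state (c e) 0)"
    using reaches_ret_state[OF p] by (simp add: e_def start_state_def pcons_def)
  then obtain n where n: "(step ^^ n) (start_state e) = ret_state (c e) 0"
    unfolding reaches_def by blast
  then have "c e = 0" if "halts_at e s" for s
    using that funpow_ret_state_unique[OF n] unfolding halts_at_def by fastforce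
  then show ?thesis using n unfolding halts_at_def by metis
qed

text \<open>Even values record programs halting with 0 on themselves, each at its unique halting
  step; all other pairs get distinct odd values, which keeps the function total and
  injective.\<close>

definition halting_enum :: "nat \<Rightarrow> nat" where
  "halting_enum m = (if halts_at (pfst m) (psnd m) then pfst m + pfst m else Suc (m + m))"

lemma recfn_halting_enum: "recfn 1 (\<lambda>xs. halting_enum (xs ! 0))"
  unfolding halting_enum_def halts_at_def start_state_def eval_state_def ret_state_def
  by (intro recfn_intros recfn_funpow[OF recfn_step]) simp_all

lemma prod_encode_pfst_psnd [simp]: "prod_encode (pfst m, psnd m) = m"
  by (simp add: pfst_def psnd_def)

lemma inj_halting_enum: "inj halting_enum"
proof (rule injI)
  fix m n assume eq: "halting_enum m = halting_enum n"
  show "m = n"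
  proof (cases "halts_at (pfst m) (psnd m)")
    case True
    \<comment> \<open>Parity forces the even case for \<open>n\<close> as well; the halting step is
      then unique.\<close>
    have "halts_at (pfst n) (psnd n) \<and> pfst m = pfst n"
      using eq True unfolding halting_enum_def by (auto split: if_splits) presburger
    then have "psnd m = psnd n" "pfst m = pfst n"
      using True funpow_ret_state_unique unfolding halts_at_def by metis+
    then show ?thesis by (metis prod_encode_pfst_psnd)
  next
    case False
    then show ?thesis using eq unfolding halting_enum_def by (auto split: if_splits) presburger
  qed
qed

lemma double_mem_range_halting_enum:
  "e + e \<in> range halting_enum \<longleftrightarrow> (\<exists>s. halts_at e s)"
proof
  assume "e + e \<in> range halting_enum"
  then obtain m where "e + e = halting_enum m" by blast
  then have "halts_at (pfst m) (psnd m) \<and> pfst m = e"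
    unfolding halting_enum_def by (cases "halts_at (pfst m) (psnd m)") (simp, presburger)
  then show "\<exists>s. halts_at e s" by blast
next
  assume "\<exists>s. halts_at e s"
  then obtain s where "halts_at e s" ..
  then have "halting_enum (prod_encode (e, s)) = e + e" by (simp add: halting_enum_def)
  then show "e + e \<in> range halting_enum" by (metis rangeI)
qed

section \<open>The deficiency set\<close>

text \<open>The stages outside this set are the true stages of the enumeration \<open>f\<close>: no
  smaller value is enumerated later.\<close>

definition deficiency_set :: "(nat \<Rightarrow> nat) \<Rightarrow> nat set" where
  "deficiency_set f = {s. \<exists>t>s. f t < f s}"

lemma infinite_Compl_deficiency_set:
  assumes "inj f"
  shows "infinite (- deficiency_set f)"
proof
  assume "finite (- deficiency_set f)"
  then obtain b where b: "\<And>s. s \<notin> deficiency_set f \<Longrightarrow> s < b"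
    using bounded_nat_set_is_finite finite_nat_set_iff_bounded by (metis ComplI)
  \<comment> \<open>Among the stages from \<open>b\<close> on, one with the smallest value of
    \<open>f\<close> is a true stage, contradicting the bound \<open>b\<close>.\<close>
  let ?P = "\<lambda>v. \<exists>t\<ge>b. f t = v"
  have "?P (LEAST v. ?P v)" by (rule LeastI[of ?P "f b"]) blast
  then obtain t where t: "t \<ge> b" "f t = (LEAST v. ?P v)" by blast
  have "t \<in> deficiency_set f" using b t(1) by force
  then obtain u where "u > t" "f u < f t" unfolding deficiency_set_def by blast
  moreover have "?P (f u)" using \<open>u > t\<close> t(1) by (intro exI[of _ u]) simp
  ultimately show False using not_less_Least[of "f u" ?P] t(2) by simp
qed

section \<open>The ceer collapsing the deficiency set\<close>

definition collapse :: "'a set \<Rightarrow> 'a rel" where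
  "collapse A = Id \<union> A \<times> A"

lemma equiv_collapse: "equiv UNIV (collapse A)"
  unfolding collapse_def by (auto intro!: equivI refl_onI symI transI)

text \<open>Unbounded search for a witness \<open>b\<close> halts exactly on \<open>R\<close>;
  \<open>b\<close> comes first because \<open>Mu\<close> prepends the searched number.\<close>

lemma ce_relI:
  assumes "recfn 3 (\<lambda>xs. F (xs ! 0) (xs ! 1) (xs ! 2))"
    and "\<And>x y. (x, y) \<in> R \<longleftrightarrow> (\<exists>b. F b x y = 0)"
  shows "ce_rel R"
proof -
  obtain p where p: "\<And>xs. length xs = 3 \<Longrightarrow> rec_eval p xs = Some (F (xs ! 0) (xs ! 1) (xs ! 2))"
    using assms(1) unfolding recfn_def by blast
  have "rec_eval p [b, x, y] = Some (F b x y)" for b x y using p[of "[b, x, y]"] by simp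
  then have "rec_eval (Mu p) [x, y] \<noteq> None \<longleftrightarrow> (x, y) \<in> R" for x y using assms(2) by simp
  then show ?thesis unfolding ce_rel_def by (intro exI[of _ "Mu p"]) auto
qed

lemma ce_rel_collapse_deficiency_set:
  assumes f: "recfn 1 (\<lambda>xs. f (xs ! 0))"
  shows "ce_rel (collapse (deficiency_set f))"
proof -
  \<comment> \<open>\<open>D b s\<close> vanishes exactly if the stage \<open>pfst b\<close>
    witnesses that \<open>s\<close> is deficient. In \<open>F\<close> one searched number supplies,
    by pairing, a witness for each of \<open>x\<close> and \<open>y\<close>.\<close>
  define D where "D b s = (Suc s - pfst b) + (Suc (f (pfst b)) - f s)" for b s
  define F where
    "F b x y = (if x = y then 0 else D (pfst b) x + D (psnd b) y)" for b x y
  have D: "(\<exists>b. D b s = 0) \<longleftrightarrow> s \<in> deficiency_set f" for s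
  proof
    assume "\<exists>b. D b s = 0"
    then obtain b where "D b s = 0" ..
    then have "s < pfst b \<and> f (pfst b) < f s" unfolding D_def by auto
    then show "s \<in> deficiency_set f" unfolding deficiency_set_def by blast
  next
    assume "s \<in> deficiency_set f"
    then obtain t where "t > s" "f t < f s" unfolding deficiency_set_def by blast
    then have "D (prod_encode (t, 0)) s = 0" by (simp add: D_def)
    then show "\<exists>b. D b s = 0" ..
  qed
  show ?thesis
  proof (rule ce_relI)
    show "recfn 3 (\<lambda>xs. F (xs ! 0) (xs ! 1) (xs ! 2))"
      unfolding F_def D_def by (intro recfn_intros recfn_comp1[OF f]) simp_all
    fix x y
    have "(\<exists>b. D (pfst b) x = 0 \<and> D (psnd b) y = 0)
        \<longleftrightarrow> (\<exists>b. D b x = 0) \<and> (\<exists>b. D b y = 0)"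
      by (metis pfst_prod_encode psnd_prod_encode)
    moreover have "(\<exists>b. F b x y = 0)
        \<longleftrightarrow> x = y \<or> (\<exists>b. D (pfst b) x = 0 \<and> D (psnd b) y = 0)"
      by (auto simp: F_def)
    ultimately have "(\<exists>b. F b x y = 0)
        \<longleftrightarrow> x = y \<or> (\<exists>b. D b x = 0) \<and> (\<exists>b. D b y = 0)" by simp
    then show "(x, y) \<in> collapse (deficiency_set f) \<longleftrightarrow> (\<exists>b. F b x y = 0)"
      using D by (auto simp: collapse_def)
  qed
qed

text \<open>Pigeonhole: by injectivity at most \<open>Suc x\<close> stages have values up to
  \<open>x\<close>.\<close>

lemma true_stage_ge:
  assumes f: "inj f" and T: "T \<subseteq> - deficiency_set f" "Suc x < card T"
  obtains s where "s \<in> T" "x < f s"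
proof -
  have "\<not> f ` T \<subseteq> {..x}"
  proof
    assume "f ` T \<subseteq> {..x}"
    then have "card (f ` T) \<le> Suc x" using card_mono[of "{..x}"] by simp
    then show False using T(2) f by (simp add: card_image inj_on_subset)
  qed
  then show ?thesis using that by fastforce
qed

text \<open>Among \<open>x + 2\<close> true stages some \<open>s\<close> has \<open>f s > x\<close>,
  and then \<open>x\<close> is not enumerated after \<open>s\<close>. So \<open>x\<close> is in the
  range only if it appears before stage \<open>h (x + 2)\<close>, which a bounded search
  decides.\<close>

lemma decidable_range_if_true_stages_bounded:
  assumes f: "recfn 1 (\<lambda>xs. f (xs ! 0))" "inj f" and h: "recfn 1 (\<lambda>xs. h (xs ! 0))"
    and T: "\<And>n. \<exists>T \<subseteq> {..h n} - deficiency_set f. card T = n"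
  shows "\<exists>d. computable d \<and> (\<forall>x. d x = 0 \<longleftrightarrow> x \<in> range f)"
proof -
  \<comment> \<open>The search stops at the first stage with value \<open>x\<close>, or by default
    at \<open>h (x + 2)\<close>; \<open>d\<close> then checks the value found.\<close>
  define t where "t x = (LEAST n. (if f n = x then 0 else h (x + 2) - n) = 0)" for x
  define d where "d x = (if f (t x) = x then 0 else (1 :: nat))" for x
  have "recfn 1 (\<lambda>xs. LEAST n. (if f n = xs ! 0 then 0 else h (xs ! 0 + 2) - n) = 0)"
  proof (rule recfn_Least)
    show "recfn (Suc 1) (\<lambda>ys. if f (ys ! 0) = drop 1 ys ! 0 then 0 else h (drop 1 ys ! 0 + 2) - ys ! 0)"
      by (intro recfn_intros recfn_comp1[OF f(1)] recfn_comp1[OF h]) simp_all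
    show "\<exists>n. (if f n = xs ! 0 then 0 else h (xs ! 0 + 2) - n) = 0" for xs
      by (rule exI[of _ "h (xs ! 0 + 2)"]) simp
  qed
  then have t: "recfn 1 (\<lambda>xs. t (xs ! 0))" unfolding t_def .
  have "recfn 1 (\<lambda>xs. d (xs ! 0))"
    unfolding d_def by (intro recfn_intros recfn_comp1[OF f(1)] recfn_comp1[OF t]) simp_all
  moreover have "f (t x) = x" if "x \<in> range f" for x
  proof -
    from that obtain n where n: "f n = x" by blast
    obtain T where T: "T \<subseteq> {..h (x + 2)} - deficiency_set f" "card T = x + 2" using T by blast
    obtain s where s: "s \<in> T" "x < f s" using true_stage_ge[OF f(2), of T x] T by auto
    have "\<not> s < n" using s n T(1) unfolding deficiency_set_def by auto
    then have "n \<le> h (x + 2)" "n \<noteq> s" using s n T(1) by auto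
    let ?P = "\<lambda>n. (if f n = x then 0 else h (x + 2) - n) = 0"
    have "?P (t x)" unfolding t_def by (rule LeastI[of ?P n]) (simp add: n)
    moreover have "t x \<le> n" unfolding t_def by (rule Least_le) (simp add: n)
    \<comment> \<open>Strictness excludes that the search ended by default.\<close>
    moreover have "n < h (x + 2)" using \<open>\<not> s < n\<close> \<open>n \<noteq> s\<close> s T(1) by fastforce
    ultimately show ?thesis by (auto split: if_splits)
  qed
  then have "d x = 0 \<longleftrightarrow> x \<in> range f" for x unfolding d_def by (auto intro: rangeI) (metis rangeI)
  ultimately show ?thesis unfolding computable_iff_recfn by blast
qed

section \<open>Growth of infinite finitely generated semigroups\<close>

abbreviation pairwise_inequivalent :: "'a rel \<Rightarrow> 'a set \<Rightarrow> bool" where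
  "pairwise_inequivalent R C \<equiv> pairwise (\<lambda>x y. (x, y) \<notin> R) C"

text \<open>Words are built by prepending letters, so it suffices that \<open>C\<close> represents
  the generators and is closed, up to congruence, under left multiplication by them.\<close>

lemma generated_congruence_generators:
  assumes gen: "\<And>x. x \<in> X \<Longrightarrow> \<exists>c\<in>C. ([x], c) \<in> generated_congruence X E"
    and step: "\<And>x c. x \<in> X \<Longrightarrow> c \<in> C \<Longrightarrow> \<exists>c'\<in>C. (x # c, c') \<in> generated_congruence X E"
    and "w \<in> free_semigroup X"
  shows "\<exists>c\<in>C. (w, c) \<in> generated_congruence X E"
  using assms(3)
proof (induction w)
  case Nil
  then show ?case by (simp add: free_semigroup_def)
next
  case (Cons x w)
  then have x: "x \<in> X" by (simp add: free_semigroup_def)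
  show ?case
  proof (cases "w = []")
    case True
    then show ?thesis using gen[OF x] by simp
  next
    case False
    then obtain c where c: "c \<in> C" "(w, c) \<in> generated_congruence X E"
      using Cons by (auto simp: free_semigroup_def)
    have "([x] @ w, [x] @ c) \<in> generated_congruence X E"
      using c x by (intro generated_congruence.left) (auto simp: free_semigroup_def)
    then show ?thesis using step[OF x c(1)] generated_congruence.trans by fastforce
  qed
qed

text \<open>Choosing for each element of \<open>D\<close> an equivalent element of \<open>C\<close>
  gives an injection.\<close>

lemma finite_pairwise_inequivalent:
  assumes "sym R" "trans R" and C: "finite C" "\<And>x. x \<in> D \<Longrightarrow> \<exists>c\<in>C. (x, c) \<in> R"
    and D: "pairwise_inequivalent R D"
  shows "finite D"
proof -
  obtain g where g: "\<And>x. x \<in> D \<Longrightarrow> g x \<in> C \<and> (x, g x) \<in> R" using C(2) by metis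
  have "inj_on g D"
  proof (rule inj_onI)
    fix x y assume xy: "x \<in> D" "y \<in> D" "g x = g y"
    then have "(x, g x) \<in> R" "(g x, y) \<in> R" using g assms(1) by (metis symD)+
    then have "(x, y) \<in> R" using assms(2) by (meson transD)
    then show "x = y" using D xy unfolding pairwise_def by blast
  qed
  then show ?thesis using g C(1) by (meson finite_imageD finite_subset image_subsetI)
qed

text \<open>Induction on \<open>n\<close>: if \<open>C\<close> met the classes of all indices up to
  the next bound, which include the generators and all products of a generator with a word indexed
  by \<open>C\<close>, then \<open>C\<close> would represent the whole semigroup, and
  \<open>D\<close> would be finite.\<close>

lemma infinite_fg_semigroup_growth:
  assumes fp: "finite_presentation X E" and e: "computable_word_bijection X e"
    and inf: "pairwise_inequivalent (word_problem X E e) D" "infinite D"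
  shows "\<exists>k. computable k \<and>
    (\<forall>n. \<exists>C \<subseteq> {..k n}. card C = n \<and> pairwise_inequivalent (word_problem X E e) C)"
proof -
  define code where "code n = list_encode (e n)" for n
  have code: "recfn 1 (\<lambda>xs. code (xs ! 0))"
    using e unfolding computable_word_bijection_def computable_iff_recfn code_def by simp
  have bij: "bij_betw e UNIV (free_semigroup X)"
    using e unfolding computable_word_bijection_def by simp
  have X: "finite X" using fp unfolding finite_presentation_def by simp
  have e_free: "e i \<in> free_semigroup X" for i using bij by (auto simp: bij_betw_def)
  have e_surj: "\<exists>i. e i = w" if "w \<in> free_semigroup X" for w
    using bij that unfolding bij_betw_def by (metis imageE)
  \<comment> \<open>The index of the product of the letter \<open>x\<close> with the word
    \<open>e i\<close>; for letters of \<open>X\<close> the search succeeds because \<open>e\<close>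
    is onto.\<close>
  define J where
    "J x i = (LEAST j. (if code j = pcons x (code i) then 0 else (1 :: nat)) = 0)" for x i
  have code_J: "\<exists>j. e j = x # e i" if "x \<in> X" for x i
    using that e_free[of i] by (intro e_surj) (simp add: free_semigroup_def)
  have code_iff: "code j = pcons x (code i) \<longleftrightarrow> e j = x # e i" for i j x
    using list_encode_eq[of "e j" "x # e i"]
    unfolding code_def list_encode_Cons .
  have J: "e (J x i) = x # e i" if "x \<in> X" for x i
  proof -
    from code_J[OF that] obtain j where "e j = x # e i" by blast
    then have "(if code j = pcons x (code i) then 0 else (1 :: nat)) = 0" by (simp add: code_iff)
    then have "(if code (J x i) = pcons x (code i) then 0 else (1 :: nat)) = 0"
      unfolding J_def by (rule LeastI)
    then show ?thesis by (simp add: code_iff split: if_splits)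
  qed
  have J_rec: "recfn 1 (\<lambda>xs. J x (xs ! 0))" if "x \<in> X" for x
    unfolding J_def
  proof (rule recfn_Least)
    show "recfn (Suc 1) (\<lambda>ys. if code (ys ! 0) = pcons x (code (drop 1 ys ! 0)) then 0 else 1)"
      by (intro recfn_intros recfn_comp1[OF code]) simp_all
    show "\<exists>n. (if code n = pcons x (code (xs ! 0)) then 0 else (1 :: nat)) = 0" for xs
      using code_J[OF that] by (simp add: code_iff)
  qed
  have SJ: "recfn 1 (\<lambda>xs. \<Sum>x\<in>X. J x (xs ! 0))" by (intro recfn_sum_finite X J_rec)
  \<comment> \<open>The double sum dominates every \<open>J x i\<close> with
    \<open>i \<le> m\<close>, and the summand \<open>m\<close> keeps the bound from
    decreasing.\<close>
  define grow where "grow m = m + (\<Sum>i\<le>m. \<Sum>x\<in>X. J x i)" for m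
  have J_le_grow: "J x i \<le> grow m" if "x \<in> X" "i \<le> m" for x i m
  proof -
    have "J x i \<le> (\<Sum>x\<in>X. J x i)" using X that by (intro member_le_sum) auto
    also have "\<dots> \<le> (\<Sum>i\<le>m. \<Sum>x\<in>X. J x i)" using that by (intro member_le_sum) auto
    finally show ?thesis by (simp add: grow_def)
  qed
  have grow_rec: "recfn 1 (\<lambda>xs. grow (xs ! 0))"
    unfolding grow_def by (intro recfn_intros recfn_sum_le[OF SJ]) simp_all
  have "\<exists>i. e i = [x]" if "x \<in> X" for x using that by (intro e_surj) (simp add: free_semigroup_def)
  then obtain a where a: "\<And>x. x \<in> X \<Longrightarrow> e (a x) = [x]" by metis
  \<comment> \<open>The initial value dominates the indices of all one-letter words.\<close>
  define k where "k n = (grow ^^ n) (\<Sum>x\<in>X. a x)" for n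
  have k_rec: "recfn 1 (\<lambda>xs. k (xs ! 0))"
    unfolding k_def by (intro recfn_funpow[OF grow_rec] recfn_intros) simp
  have k_Suc: "k (Suc n) = grow (k n)" for n unfolding k_def by simp
  have a_le: "a x \<le> k n" if "x \<in> X" for x n
  proof (induction n)
    case 0
    show ?case using X that by (auto simp: k_def intro: member_le_sum)
  next
    case (Suc n)
    then show ?case by (simp add: k_Suc grow_def)
  qed
  let ?R = "word_problem X E e"
  have R: "refl ?R" "sym ?R" "trans ?R"
    unfolding word_problem_def
    by (auto intro!: refl_onI symI transI e_free intro: generated_congruence.intros)
  have "\<exists>C \<subseteq> {..k n}. card C = n \<and> pairwise_inequivalent ?R C" for n
  proof (induction n)
    case 0
    show ?case by (rule exI[of _ "{}"]) simp
  next
    case (Suc n)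
    then obtain C where C: "C \<subseteq> {..k n}" "card C = n" "pairwise_inequivalent ?R C" by blast
    have "finite C" using C(1) finite_subset by blast
    have "\<exists>j\<le>k (Suc n). \<forall>i\<in>C. (j, i) \<notin> ?R"
    proof (rule ccontr)
      assume "\<not> ?thesis"
      then have cov: "\<exists>i\<in>C. (j, i) \<in> ?R" if "j \<le> k (Suc n)" for j using that by blast
      have "\<exists>c\<in>e ` C. (w, c) \<in> generated_congruence X E" if "w \<in> free_semigroup X" for w
      proof (rule generated_congruence_generators[OF _ _ that])
        fix x assume "x \<in> X"
        then show "\<exists>c\<in>e ` C. ([x], c) \<in> generated_congruence X E"
          using cov[OF a_le] a by (auto simp: word_problem_def)
      next
        fix x c assume xc: "x \<in> X" "c \<in> e ` C"
        then obtain i where i: "i \<in> C" "c = e i" by blast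
        have "J x i \<le> k (Suc n)" using i C(1) xc by (auto simp: k_Suc intro!: J_le_grow)
        then show "\<exists>c'\<in>e ` C. (x # c, c') \<in> generated_congruence X E"
          using cov[of "J x i"] J[OF xc(1)] i by (auto simp: word_problem_def)
      qed
      then have "\<exists>c\<in>C. (j, c) \<in> ?R" for j using e_free[of j] by (auto simp: word_problem_def)
      then have "finite D"
        using finite_pairwise_inequivalent[OF R(2,3) \<open>finite C\<close> _ inf(1)] by blast
      then show False using inf(2) by contradiction
    qed
    then obtain j where j: "j \<le> k (Suc n)" "\<forall>i\<in>C. (j, i) \<notin> ?R" by blast
    have "j \<notin> C" using j(2) R(1) by (auto dest: refl_onD)
    then have "card (insert j C) = Suc n" using C(2) \<open>finite C\<close> by simp
    moreover have "insert j C \<subseteq> {..k (Suc n)}" using j(1) C(1) by (force simp: k_Suc grow_def)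
    moreover have "pairwise_inequivalent ?R (insert j C)"
      using C(3) j(2) R(2) by (auto simp: pairwise_insert dest: symD)
    ultimately show ?case by blast
  qed
  then show ?thesis using k_rec unfolding computable_iff_recfn by blast
qed

text \<open>A reduction is injective on inequivalent indices and sends at most one of them into the
  single class \<open>A\<close>.\<close>

lemma infinite_fg_semigroup_reducible_collapse:
  assumes fp: "finite_presentation X E" and e: "computable_word_bijection X e"
    and inf: "pairwise_inequivalent (word_problem X E e) D" "infinite D"
    and red: "word_problem X E e \<preceq>\<^sub>c collapse A"
  shows "\<exists>h. computable h \<and> (\<forall>n. \<exists>T \<subseteq> {..h n} - A. card T = n)"
proof -
  obtain g where g: "computable g"
    "\<And>i j. (i, j) \<in> word_problem X E e \<longleftrightarrow> (g i, g j) \<in> collapse A"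
    using red unfolding reducible_def by blast
  obtain k where k: "computable k"
    and C: "\<And>n. \<exists>C \<subseteq> {..k n}. card C = n \<and> pairwise_inequivalent (word_problem X E e) C"
    using infinite_fg_semigroup_growth[OF fp e inf] by blast
  \<comment> \<open>\<open>Suc n\<close> allows for the one value possibly lost in \<open>A\<close>;
    the sum bounds every \<open>g i\<close> with \<open>i \<le> k (Suc n)\<close>.\<close>
  define h where "h n = (\<Sum>i\<le>k (Suc n). g i)" for n
  have rec: "recfn 1 (\<lambda>xs. g (xs ! 0))" "recfn 1 (\<lambda>xs. k (xs ! 0))"
    using g(1) k unfolding computable_iff_recfn by auto
  have "recfn 1 (\<lambda>xs. h (xs ! 0))"
    unfolding h_def by (intro recfn_sum_le[OF rec(1)] recfn_comp1[OF rec(2)] recfn_intros) simp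
  moreover have "\<exists>T \<subseteq> {..h n} - A. card T = n" for n
  proof -
    obtain C where C: "C \<subseteq> {..k (Suc n)}" "card C = Suc n"
      "pairwise_inequivalent (word_problem X E e) C"
      using C by blast
    have inj: "inj_on g C"
    proof (rule inj_onI, rule ccontr)
      fix x y assume "x \<in> C" "y \<in> C" "g x = g y" "x \<noteq> y"
      then show False using C(3) g(2)[of x y] by (auto simp: pairwise_def collapse_def)
    qed
    have "finite C" using C(2) card.infinite by fastforce
    have le: "g ` C \<subseteq> {..h n}"
      using C(1) unfolding h_def by (auto intro!: member_le_sum)
    have "card (g ` C \<inter> A) \<le> 1"
    proof (rule card_le_Suc0_iff_eq[THEN iffD2, unfolded One_nat_def[symmetric]])
      show "finite (g ` C \<inter> A)" using \<open>finite C\<close> by simp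
      show "\<forall>x\<in>g ` C \<inter> A. \<forall>y\<in>g ` C \<inter> A. x = y"
      proof (intro ballI)
        fix x y assume "x \<in> g ` C \<inter> A" "y \<in> g ` C \<inter> A"
        then obtain i j where ij: "x = g i" "y = g j" "i \<in> C" "j \<in> C" "g i \<in> A" "g j \<in> A" by blast
        then have "(i, j) \<in> word_problem X E e" using g(2) by (simp add: collapse_def)
        then have "i = j" using C(3) ij by (auto simp: pairwise_def)
        then show "x = y" using ij by simp
      qed
    qed
    moreover have "card (g ` C) = Suc n" using inj C(2) by (simp add: card_image)
    moreover have "card (g ` C) = card (g ` C \<inter> A) + card (g ` C - A)"
      using \<open>finite C\<close> by (metis card_Int_Diff finite_imageI)
    ultimately have "n \<le> card (g ` C - A)" by linarith
    then obtain T where T: "T \<subseteq> g ` C - A" "card T = n" by (meson obtain_subset_with_card_n)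
    moreover have "T \<subseteq> {..h n} - A" using T(1) le by auto
    ultimately show ?thesis by auto
  qed
  ultimately show ?thesis unfolding computable_iff_recfn by blast
qed

theorem corollary3p10:
  "\<exists>R. ceer R \<and>
     (\<forall>(X :: nat set) (E :: nat list rel) (e :: nat \<Rightarrow> nat list).
        finite_presentation X E \<longrightarrow> computable_word_bijection X e \<longrightarrow>
        \<not> R \<equiv>\<^sub>c word_problem X E e)"
proof (intro exI conjI allI impI notI)
  let ?A = "deficiency_set halting_enum"
  show "ceer (collapse ?A)"
    unfolding ceer_def
    using equiv_collapse ce_rel_collapse_deficiency_set[OF recfn_halting_enum] by blast
  fix X :: "nat set" and E :: "nat list rel" and e :: "nat \<Rightarrow> nat list"
  assume fp: "finite_presentation X E" and e: "computable_word_bijection X e"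
    and eq: "collapse ?A \<equiv>\<^sub>c word_problem X E e"
  obtain f where f: "\<And>x y. (x, y) \<in> collapse ?A \<longleftrightarrow> (f x, f y) \<in> word_problem X E e"
    using eq unfolding bireducible_def reducible_def by blast
  have refl: "(f x, f x) \<in> word_problem X E e" for x
    using f[of x x] by (simp add: collapse_def)
  \<comment> \<open>Numbers outside \<open>?A\<close> are alone in their classes, so
    \<open>f\<close> carries the infinite complement to infinitely many inequivalent indices: the
    semigroup is infinite.\<close>
  have inequiv: "(f x, f y) \<notin> word_problem X E e" if "x \<noteq> y" "x \<notin> ?A" for x y
    using that f[of x y] by (auto simp: collapse_def)
  have "inj_on f (- ?A)"
  proof (rule inj_onI, rule ccontr)
    fix x y assume "x \<in> - ?A" "f x = f y" "x \<noteq> y"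
    then show False using inequiv[of x y] refl[of x] by simp
  qed
  then have "infinite (f ` (- ?A))"
    using infinite_Compl_deficiency_set[OF inj_halting_enum] finite_imageD by blast
  moreover have "pairwise_inequivalent (word_problem X E e) (f ` (- ?A))"
    using inequiv by (intro pairwise_imageI) auto
  moreover have "word_problem X E e \<preceq>\<^sub>c collapse ?A" using eq by (simp add: bireducible_def)
  ultimately obtain h where h: "computable h" "\<forall>n. \<exists>T \<subseteq> {..h n} - ?A. card T = n"
    using infinite_fg_semigroup_reducible_collapse[OF fp e, of "f ` (- ?A)" ?A] by auto
  obtain d where d: "computable d" "\<forall>x. d x = 0 \<longleftrightarrow> x \<in> range halting_enum"
    using decidable_range_if_true_stages_bounded[OF recfn_halting_enum inj_halting_enum
        h(1)[unfolded computable_iff_recfn] h(2)[rule_format]] by (elim exE conjE)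
  \<comment> \<open>This function vanishes at \<open>x\<close> exactly when \<open>x + x\<close> is
    outside the range of \<open>halting_enum\<close>, that is, when program \<open>x\<close> does
    not halt with 0 on itself; the diagonal lemma refutes this.\<close>
  have "computable (\<lambda>x. 1 - d (x + x))"
    unfolding computable_iff_recfn
    by (intro recfn_intros recfn_comp1[OF d(1)[unfolded computable_iff_recfn]]) simp_all
  from computable_diagonal[OF this]
  obtain c where "1 - d (c + c) = 0 \<longleftrightarrow> (\<exists>s. halts_at c s)" ..
  then show False using d(2)[rule_format, of "c + c"] double_mem_range_halting_enum[of c]
    by (cases "d (c + c)") auto
qed

end
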